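(* Let $G$ and $H$ be paratopological groups and let $f\colon G\to H$ be a continuous $d$-open surjective homomorphism. If $G$ is $\mathbb{R}$-factorizable, then $H$ is $\mathbb{R}$-factorizable.
   Context: A paratopological group is a group with a topology such that multiplication $G\times G\to G$ is jointly continuous (inversion need not be continuous). No separation axioms are assumed on spaces or groups. A mapping $f\colon X\to Y$ of topological spaces is $d$-open if for every open set $O$ of $X$ there exists an open set $V$ of $f(X)$ such that $f(O)$ is a dense subset of $V$. A paratopological group $G$ is $\mathbb{R}$-factorizable if for every continuous function $\varphi\colon G\to\mathbb{R}$ there exist a continuous homomorphism $\pi\colon G\to K$ onto a second-countable paratopological group $K$ (no separation axiom imposed on $K$) and a continuous function $h\colon K\to\mathbb{R}$ such that $\varphi=h\circ\pi$. *)

theory Defs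
  imports "HOL-Analysis.Analysis" "HOL-Algebra.Group"
begin

locale paratopological_group = group G for G (structure) and T +
  assumes topspace_eq: "topspace T = carrier G"
    and continuous_mult: "continuous_map (prod_topology T T) T (\<lambda>(x, y). x \<otimes> y)"

definition d_open_map :: "'a topology \<Rightarrow> 'b topology \<Rightarrow> ('a \<Rightarrow> 'b) \<Rightarrow> bool" where
  "d_open_map X Y f \<longleftrightarrow>
     f ` topspace X \<subseteq> topspace Y \<and>
     (\<forall>U. openin X U \<longrightarrow>
        (\<exists>V. openin (subtopology Y (f ` topspace X)) V \<and>
             f ` U \<subseteq> V \<and> subtopology Y V closure_of (f ` U) = V))"

definition factors_through ::
  "('a, 'm) monoid_scheme \<Rightarrow> 'a topology \<Rightarrow> ('a \<Rightarrow> real) \<Rightarrow>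
   ('k, 'n) monoid_scheme \<Rightarrow> 'k topology \<Rightarrow> bool" where
  "factors_through G T \<phi> K S \<longleftrightarrow>
     (\<exists>\<pi> h. \<pi> \<in> epi G K \<and> continuous_map T S \<pi> \<and>
            continuous_map S euclideanreal h \<and>
            (\<forall>x \<in> carrier G. \<phi> x = h (\<pi> x)))"

text \<open>
  HOL cannot quantify existentially over the carrier type of the group \<open>K\<close>. Since \<open>K\<close> is a
  homomorphic image of \<open>G\<close>, it can be relabelled by the fibres of the homomorphism, so that
  letting \<open>K\<close> range over groups whose elements are sets of elements of \<open>G\<close> loses nothing:
  see lemma \<open>factors_through_transfer\<close> below.
\<close>

definition R_factorizable :: "('a, 'm) monoid_scheme \<Rightarrow> 'a topology \<Rightarrow> bool" where
  "R_factorizable G T \<longleftrightarrow>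
     (\<forall>\<phi>. continuous_map T euclideanreal \<phi> \<longrightarrow>
        (\<exists>(K :: 'a set monoid) S.
           paratopological_group K S \<and> second_countable S \<and> factors_through G T \<phi> K S))"

lemma factors_through_transfer:
  fixes G :: "('a, 'm) monoid_scheme" and K :: "('k, 'n) monoid_scheme"
  assumes K: "paratopological_group K S" and sc: "second_countable S"
    and fac: "factors_through G T \<phi> K S"
  shows "\<exists>(K' :: 'a set monoid) S'.
           paratopological_group K' S' \<and> second_countable S' \<and> factors_through G T \<phi> K' S'"
proof -
  interpret K: paratopological_group K S by (rule K)
  obtain \<pi> h where \<pi>: "\<pi> \<in> hom G K" "\<pi> ` carrier G = carrier K"
    and cont: "continuous_map T S \<pi>" and h: "continuous_map S euclideanreal h"
    and \<phi>: "\<And>x. x \<in> carrier G \<Longrightarrow> \<phi> x = h (\<pi> x)"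
    using fac unfolding factors_through_def epi_def by blast
  define c where "c k = {x \<in> carrier G. \<pi> x = k}" for k
  define C where "C = c ` carrier K"
  define g where "g = inv_into (carrier K) c"
  have inj: "inj_on c (carrier K)"
    unfolding inj_on_def c_def using \<pi>(2) by (smt (verit) image_iff mem_Collect_eq)
  have gc [simp]: "g (c k) = k" if "k \<in> carrier K" for k
    using inj that by (simp add: g_def)
  have gC [simp]: "g A \<in> carrier K" "c (g A) = A" if "A \<in> C" for A
    using that by (auto simp: C_def)
  have cC [simp]: "c k \<in> C" if "k \<in> carrier K" for k
    using that by (simp add: C_def)
  define K' :: "'a set monoid" where
    "K' = \<lparr>carrier = C, mult = (\<lambda>A B. c (g A \<otimes>\<^bsub>K\<^esub> g B)), one = c \<one>\<^bsub>K\<^esub>\<rparr>"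
  define S' where "S' = pullback_topology C g S"
  have top': "topspace S' = C"
    using gC by (auto simp: S'_def topspace_pullback_topology K.topspace_eq)
  have gcont: "continuous_map S' S g"
    unfolding S'_def using continuous_map_pullback[OF continuous_map_id[of S]] by simp
  have ccont: "continuous_map S S' c"
    unfolding S'_def
  proof (rule continuous_map_pullback')
    show "continuous_map S S (g \<circ> c)"
      by (rule continuous_map_eq[OF continuous_map_id]) (simp add: K.topspace_eq)
    show "topspace S \<subseteq> c -` C"
      by (auto simp: K.topspace_eq)
  qed
  have "homeomorphic_maps S S' c g"
    using gcont ccont by (simp add: homeomorphic_maps_def top' K.topspace_eq)
  then have "S homeomorphic_space S'"
    by (auto simp: homeomorphic_space_def)
  then have sc': "second_countable S'"
    using sc homeomorphic_space_second_countability by blast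
  have grp: "group K'"
  proof (rule groupI)
    fix A assume "A \<in> carrier K'"
    then have A: "A \<in> C" by (simp add: K'_def)
    show "\<exists>B \<in> carrier K'. B \<otimes>\<^bsub>K'\<^esub> A = \<one>\<^bsub>K'\<^esub>"
      by (rule bexI[of _ "c (inv\<^bsub>K\<^esub> (g A))"]) (use A in \<open>simp_all add: K'_def K.l_inv\<close>)
  qed (auto simp: K'_def K.m_assoc)
  have mult: "continuous_map (prod_topology S' S') S' (\<lambda>(x, y). x \<otimes>\<^bsub>K'\<^esub> y)"
  proof -
    have "continuous_map (prod_topology S' S') (prod_topology S S) (\<lambda>p. (g (fst p), g (snd p)))"
      using continuous_map_compose[OF continuous_map_fst gcont]
            continuous_map_compose[OF continuous_map_snd gcont]
      by (auto simp: continuous_map_pairwise o_def)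
    from continuous_map_compose[OF continuous_map_compose[OF this K.continuous_mult] ccont]
    show ?thesis
      by (simp add: K'_def o_def case_prod_unfold)
  qed
  have P: "paratopological_group K' S'"
    unfolding paratopological_group_def paratopological_group_axioms_def
    using grp mult top' by (simp add: K'_def)
  have \<pi>c: "\<pi> x \<in> carrier K" if "x \<in> carrier G" for x
    using \<pi>(2) that by auto
  have "factors_through G T \<phi> K' S'"
    unfolding factors_through_def
  proof (intro exI conjI ballI)
    have "(c \<circ> \<pi>) ` carrier G = C"
      using \<pi>(2) by (metis C_def image_comp)
    then show "c \<circ> \<pi> \<in> epi G K'"
      using \<pi>c hom_mult[OF \<pi>(1)] by (auto simp: epi_def hom_def K'_def)
    show "continuous_map T S' (c \<circ> \<pi>)"
      using cont ccont by (rule continuous_map_compose)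
    show "continuous_map S' euclideanreal (h \<circ> g)"
      using gcont h by (rule continuous_map_compose)
    show "\<phi> x = (h \<circ> g) ((c \<circ> \<pi>) x)" if "x \<in> carrier G" for x
      using that \<phi> \<pi>c by simp
  qed
  with P sc' show ?thesis by blast
qed

end

theory Submission
  imports Defs
begin

text \<open>
  Write \<open>\<phi> \<circ> f = h \<circ> \<pi>\<close> with \<open>\<pi>\<close> a continuous homomorphism of \<open>G\<close> onto a second-countable \<open>K\<close>.
  The sets \<open>f (\<pi>\<^sup>-\<^sup>1 V)\<close> with \<open>V\<close> open in \<open>K\<close> form a second-countable paratopological group
  topology \<open>\<tau>\<close> on \<open>H\<close> making \<open>\<phi>\<close> continuous; it is the topology pulled back
  from the quotient of \<open>K\<close> by \<open>\<pi> (ker f)\<close>. As \<open>f\<close> is only \<open>d\<close>-open, \<open>\<tau>\<close> need not be coarser than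
  the topology \<open>T\<close> of \<open>H\<close>, but every \<open>\<tau>\<close>-open set \<open>V\<close> lies in the \<open>T\<close>-interior of its \<open>T\<close>-closure.
  Replacing the \<open>\<tau>\<close>-neighbourhoods \<open>V\<close> by these larger sets gives a second-countable group topology
  coarser than \<open>T\<close>, and \<open>\<phi>\<close> stays continuous because the real line is regular.
  So \<open>H\<close> itself, with this topology and the identity homomorphism, is the required factor.
\<close>

section \<open>Translations and products of closures in a paratopological group\<close>

context paratopological_group
begin

lemma openin_carrier: "openin T U \<Longrightarrow> x \<in> U \<Longrightarrow> x \<in> carrier G"
  using openin_subset topspace_eq by blast

lemma openin_mult:
  assumes "openin T W" "x \<in> carrier G" "y \<in> carrier G" "x \<otimes> y \<in> W"
  obtains U V where "openin T U" "openin T V" "x \<in> U" "y \<in> V"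
    "\<And>a b. a \<in> U \<Longrightarrow> b \<in> V \<Longrightarrow> a \<otimes> b \<in> W"
proof -
  define P where "P = {p \<in> topspace (prod_topology T T). (\<lambda>(x, y). x \<otimes> y) p \<in> W}"
  have "openin (prod_topology T T) P"
    unfolding P_def using continuous_mult assms(1) by (rule openin_continuous_map_preimage)
  moreover have "(x, y) \<in> P"
    using assms by (simp add: P_def topspace_eq)
  ultimately have "\<exists>U V. openin T U \<and> openin T V \<and> x \<in> U \<and> y \<in> V \<and> U \<times> V \<subseteq> P"
    unfolding openin_prod_topology_alt by simp
  then obtain U V where "openin T U" "openin T V" "x \<in> U" "y \<in> V" "U \<times> V \<subseteq> P"
    by blast
  then show thesis
    by (intro that[of U V]) (auto simp: P_def)
qed

text \<open>This is joint continuity with the first factor frozen. Applied to the inverse of an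
  element, it shows that left translates of open sets are open, although inversion need not be
  continuous.\<close>

lemma openin_left_translation:
  assumes "openin T V" "x \<in> carrier G"
  shows "openin T {y \<in> carrier G. x \<otimes> y \<in> V}"
proof (subst openin_subopen, safe)
  fix y assume y: "y \<in> carrier G" "x \<otimes> y \<in> V"
  obtain U W where "openin T W" "x \<in> U" "y \<in> W" "\<And>a b. a \<in> U \<Longrightarrow> b \<in> W \<Longrightarrow> a \<otimes> b \<in> V"
    using openin_mult[OF assms y] by metis
  then show "\<exists>W. openin T W \<and> y \<in> W \<and> W \<subseteq> {y \<in> carrier G. x \<otimes> y \<in> V}"
    using openin_carrier by blast
qed

lemma openin_right_translation:
  assumes "openin T V" "x \<in> carrier G"
  shows "openin T {y \<in> carrier G. y \<otimes> x \<in> V}"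
proof (subst openin_subopen, safe)
  fix y assume y: "y \<in> carrier G" "y \<otimes> x \<in> V"
  obtain U W where "openin T W" "x \<in> U" "y \<in> W" "\<And>a b. a \<in> W \<Longrightarrow> b \<in> U \<Longrightarrow> a \<otimes> b \<in> V"
    using openin_mult[OF assms(1) y(1) assms(2) y(2)] by metis
  then show "\<exists>W. openin T W \<and> y \<in> W \<and> W \<subseteq> {y \<in> carrier G. y \<otimes> x \<in> V}"
    using openin_carrier by blast
qed

text \<open>Given a neighbourhood of the product, joint continuity yields neighbourhoods of
  \<open>x\<close> and \<open>y\<close> whose products stay in it; they meet \<open>A\<close> and
  \<open>B\<close>.\<close>

lemma closure_of_mult:
  assumes "x \<in> T closure_of A" "y \<in> T closure_of B"
    and "\<And>a b. a \<in> A \<Longrightarrow> b \<in> B \<Longrightarrow> a \<otimes> b \<in> C"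
  shows "x \<otimes> y \<in> T closure_of C"
  unfolding in_closure_of
proof (intro conjI allI impI)
  have xy: "x \<in> carrier G" "y \<in> carrier G"
    using assms(1,2) by (auto simp: in_closure_of topspace_eq)
  then show "x \<otimes> y \<in> topspace T"
    by (simp add: topspace_eq)
  fix W assume W: "x \<otimes> y \<in> W \<and> openin T W"
  obtain U V where "openin T U" "openin T V" "x \<in> U" "y \<in> V"
    and UV: "\<And>a b. a \<in> U \<Longrightarrow> b \<in> V \<Longrightarrow> a \<otimes> b \<in> W"
    using openin_mult[of W x y] W xy by metis
  then obtain a b where "a \<in> A" "a \<in> U" "b \<in> B" "b \<in> V"
    using assms(1,2) unfolding in_closure_of by meson
  then show "\<exists>c. c \<in> C \<and> c \<in> W"
    using UV assms(3) by blast
qed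

text \<open>Translating the interior neighbourhood of \<open>y\<close> by \<open>x\<close> gives an
  open set, which \<open>closure_of_mult\<close> places inside the closure of \<open>C\<close>.
  Since \<open>x\<close> only has to lie in a closure, a singleton can serve as
  \<open>A\<close>.\<close>

lemma interior_closure_of_mult:
  assumes x: "x \<in> T closure_of A" and y: "y \<in> T interior_of (T closure_of B)"
    and AB: "\<And>a b. a \<in> A \<Longrightarrow> b \<in> B \<Longrightarrow> a \<otimes> b \<in> C"
  shows "x \<otimes> y \<in> T interior_of (T closure_of C)"
proof -
  let ?N = "T interior_of (T closure_of B)"
  \<comment> \<open>The translate of \<open>?N\<close> by \<open>x\<close>, written as a preimage
    under translation by \<open>inv x\<close>, so that \<open>openin_left_translation\<close>
    applies.\<close>
  let ?P = "{d \<in> carrier G. inv x \<otimes> d \<in> ?N}"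
  have xy: "x \<in> carrier G" "y \<in> carrier G"
    using x y openin_carrier[OF openin_interior_of] by (auto simp: in_closure_of topspace_eq)
  have "openin T ?P"
    by (rule openin_left_translation) (use xy in auto)
  moreover have "?P \<subseteq> T closure_of C"
  proof clarify
    fix d assume d: "d \<in> carrier G" "inv x \<otimes> d \<in> ?N"
    then have "x \<otimes> (inv x \<otimes> d) \<in> T closure_of C"
      using closure_of_mult[OF x _ AB] interior_of_subset[of T "T closure_of B"] by blast
    then show "d \<in> T closure_of C"
      using xy d by (simp add: m_assoc[symmetric])
  qed
  moreover have "x \<otimes> y \<in> ?P"
    using xy y by (simp add: m_assoc[symmetric])
  ultimately show ?thesis
    using interior_of_maximal by blast
qed

end

section \<open>A coarser second-countable group topology\<close>

text \<open>
  The topology \<open>\<sigma>\<close> below is defined by its neighbourhoods: the sets \<open>nb V\<close> themselves need not be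
  \<open>\<sigma>\<close>-open, only their \<open>\<sigma>\<close>-interiors \<open>intr (nb V)\<close> are.
\<close>

lemma coarser_paratopological_group:
  fixes G :: "('a, 'm) monoid_scheme" and T \<tau> :: "'a topology" and \<phi> :: "'a \<Rightarrow> real"
  assumes T: "paratopological_group G T" and \<tau>: "paratopological_group G \<tau>"
    and sc: "second_countable \<tau>"
    and near: "\<And>V. openin \<tau> V \<Longrightarrow> V \<subseteq> T interior_of (T closure_of V)"
    and \<phi>T: "continuous_map T euclideanreal \<phi>" and \<phi>\<tau>: "continuous_map \<tau> euclideanreal \<phi>"
  obtains \<sigma> where "paratopological_group G \<sigma>" "second_countable \<sigma>"
    "continuous_map T \<sigma> id" "continuous_map \<sigma> euclideanreal \<phi>"
proof -
  interpret T: paratopological_group G T by (rule T)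
  interpret \<tau>: paratopological_group G \<tau> by (rule \<tau>)
  \<comment> \<open>Two topologies are mixed: \<open>V\<close> is meant to be
    \<open>\<tau>\<close>-open, while interior and closure are taken in \<open>T\<close>.\<close>
  define nb where "nb V = T interior_of (T closure_of V)" for V
  define intr where "intr A = {x. \<exists>V. openin \<tau> V \<and> x \<in> V \<and> nb V \<subseteq> A}" for A
  \<comment> \<open>Open means being a neighbourhood of each of its points. Monotonicity of
    \<open>intr\<close> and \<open>intr_Int\<close> make this a topology; that \<open>intr A\<close>
    is itself open is a separate fact, \<open>open_intr\<close>, which uses the group
    structure.\<close>
  define \<sigma> where "\<sigma> = topology (\<lambda>U. U \<subseteq> carrier G \<and> U \<subseteq> intr U)"
  have nb_mono: "V \<subseteq> W \<Longrightarrow> nb V \<subseteq> nb W" for V W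
    by (simp add: nb_def interior_of_mono closure_of_mono)
  have nb_carrier: "nb V \<subseteq> carrier G" for V
    using openin_subset[OF openin_interior_of] by (metis nb_def T.topspace_eq)
  have nb_closure: "nb V \<subseteq> T closure_of V" for V
    by (simp add: nb_def interior_of_subset)
  have intr_mono: "A \<subseteq> B \<Longrightarrow> intr A \<subseteq> intr B" for A B
    unfolding intr_def by blast
  have intr_Int: "intr A \<inter> intr B \<subseteq> intr (A \<inter> B)" for A B
  proof
    fix x assume "x \<in> intr A \<inter> intr B"
    then obtain V W where "openin \<tau> V" "openin \<tau> W" "x \<in> V" "x \<in> W" "nb V \<subseteq> A" "nb W \<subseteq> B"
      unfolding intr_def by blast
    then have "openin \<tau> (V \<inter> W)" "x \<in> V \<inter> W" "nb (V \<inter> W) \<subseteq> A \<inter> B"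
      using nb_mono[of "V \<inter> W" V] nb_mono[of "V \<inter> W" W] by auto
    then show "x \<in> intr (A \<inter> B)"
      unfolding intr_def by blast
  qed
  have "istopology (\<lambda>U. U \<subseteq> carrier G \<and> U \<subseteq> intr U)"
    unfolding istopology_def
  proof (intro conjI allI impI)
    fix \<K> assume K: "\<forall>U\<in>\<K>. U \<subseteq> carrier G \<and> U \<subseteq> intr U"
    then show "\<Union>\<K> \<subseteq> carrier G" by blast
    show "\<Union>\<K> \<subseteq> intr (\<Union>\<K>)"
      using K intr_mono[OF Union_upper] by blast
  qed (use intr_Int in blast)+
  then have open_\<sigma>: "openin \<sigma> U \<longleftrightarrow> U \<subseteq> carrier G \<and> U \<subseteq> intr U" for U
    by (simp add: \<sigma>_def topology_inverse')
  have nb_intr: "V \<subseteq> intr (nb V)" if "openin \<tau> V" for V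
    using that unfolding intr_def by blast
  have intr_subset: "intr A \<subseteq> A" for A
    using near unfolding intr_def nb_def by blast
  \<comment> \<open>Inclusions between products pass to the enlarged sets; this carries continuity
    of multiplication from \<open>\<tau>\<close> over to \<open>\<sigma>\<close>.\<close>
  have nb_mult: "x \<otimes>\<^bsub>G\<^esub> y \<in> nb W"
    if "x \<in> nb U" "y \<in> nb V" "\<And>a b. a \<in> U \<Longrightarrow> b \<in> V \<Longrightarrow> a \<otimes>\<^bsub>G\<^esub> b \<in> W" for x y U V W
    using T.interior_closure_of_mult[of x U y V W] that nb_closure unfolding nb_def by blast
  have open_intr: "openin \<sigma> (intr A)" if "A \<subseteq> carrier G" for A
    unfolding open_\<sigma>
  proof (intro conjI subsetI)
    show "x \<in> carrier G" if "x \<in> intr A" for x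
      using that intr_subset \<open>A \<subseteq> carrier G\<close> by blast
    fix x assume "x \<in> intr A"
    then obtain V where V: "openin \<tau> V" "x \<in> V" "nb V \<subseteq> A"
      unfolding intr_def by blast
    have x: "x \<in> carrier G"
      using V \<tau>.openin_carrier by blast
    \<comment> \<open>Continuity at \<open>x\<close> times the unit leaves room to move: for every
      \<open>y\<close> in \<open>nb V1\<close>, the translate of \<open>V2\<close> by
      \<open>y\<close> will witness \<open>y \<in> intr A\<close>.\<close>
    obtain V1 V2 where V1: "openin \<tau> V1" "x \<in> V1" and V2: "openin \<tau> V2" "\<one>\<^bsub>G\<^esub> \<in> V2"
      and V12: "\<And>a b. a \<in> V1 \<Longrightarrow> b \<in> V2 \<Longrightarrow> a \<otimes>\<^bsub>G\<^esub> b \<in> V"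
      using \<tau>.openin_mult[of V x "\<one>\<^bsub>G\<^esub>"] V x by (metis T.one_closed T.r_one)
    have "nb V1 \<subseteq> intr A"
    proof
      fix y assume y: "y \<in> nb V1"
      then have yc: "y \<in> carrier G" using nb_carrier by blast
      let ?W = "{d \<in> carrier G. inv\<^bsub>G\<^esub> y \<otimes>\<^bsub>G\<^esub> d \<in> V2}"
      have "openin \<tau> ?W"
        by (rule \<tau>.openin_left_translation) (use V2 yc in auto)
      moreover have "y \<in> ?W"
        using yc V2 by simp
      moreover have "nb ?W \<subseteq> nb V"
      proof
        fix c assume c: "c \<in> nb ?W"
        then have cc: "c \<in> carrier G" using nb_carrier by blast
        have "inv\<^bsub>G\<^esub> y \<in> T closure_of {inv\<^bsub>G\<^esub> y}"
          using closure_of_subset[of "{inv\<^bsub>G\<^esub> y}" T] yc by (simp add: T.topspace_eq)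
        \<comment> \<open>Translation by the inverse of \<open>y\<close>, seen as a product with a
          singleton, moves \<open>nb ?W\<close> into \<open>nb V2\<close>. Multiplying back by
          \<open>y\<close>, now as a point of \<open>nb V1\<close>, lands in
          \<open>nb V\<close>.\<close>
        then have "inv\<^bsub>G\<^esub> y \<otimes>\<^bsub>G\<^esub> c \<in> nb V2"
          using T.interior_closure_of_mult[of "inv\<^bsub>G\<^esub> y" "{inv\<^bsub>G\<^esub> y}" c ?W V2] c
          unfolding nb_def by blast
        then have "y \<otimes>\<^bsub>G\<^esub> (inv\<^bsub>G\<^esub> y \<otimes>\<^bsub>G\<^esub> c) \<in> nb V"
          using nb_mult[OF y _ V12] by blast
        then show "c \<in> nb V"
          using yc cc by (simp add: T.m_assoc[symmetric])
      qed
      ultimately show "y \<in> intr A"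
        using V(3) unfolding intr_def by blast
    qed
    then show "x \<in> intr (intr A)"
      using V1 unfolding intr_def by blast
  qed
  have "carrier G \<subseteq> intr (carrier G)"
    using nb_intr[OF openin_topspace[of \<tau>]] intr_mono[OF nb_carrier]
    by (metis \<tau>.topspace_eq subset_trans)
  then have top: "topspace \<sigma> = carrier G"
    by (metis open_\<sigma> openin_subset openin_topspace order_refl subset_antisym)
  have mult: "continuous_map (prod_topology \<sigma> \<sigma>) \<sigma> (\<lambda>(x, y). x \<otimes>\<^bsub>G\<^esub> y)"
    unfolding continuous_map_def
  proof (intro conjI allI impI)
    show "(\<lambda>(x, y). x \<otimes>\<^bsub>G\<^esub> y) \<in> topspace (prod_topology \<sigma> \<sigma>) \<rightarrow> topspace \<sigma>"
      by (auto simp: top)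
    fix U assume U: "openin \<sigma> U"
    let ?P = "{p \<in> topspace (prod_topology \<sigma> \<sigma>). (\<lambda>(x, y). x \<otimes>\<^bsub>G\<^esub> y) p \<in> U}"
    show "openin (prod_topology \<sigma> \<sigma>) ?P"
      unfolding openin_prod_topology_alt
    proof (intro allI impI)
      fix x y assume "(x, y) \<in> ?P"
      then have xy: "x \<in> carrier G" "y \<in> carrier G" "x \<otimes>\<^bsub>G\<^esub> y \<in> U"
        by (auto simp: top)
      then obtain W where W: "openin \<tau> W" "x \<otimes>\<^bsub>G\<^esub> y \<in> W" "nb W \<subseteq> U"
        using U unfolding open_\<sigma> intr_def by blast
      obtain V1 V2 where V: "openin \<tau> V1" "x \<in> V1" "openin \<tau> V2" "y \<in> V2"
        and V12: "\<And>a b. a \<in> V1 \<Longrightarrow> b \<in> V2 \<Longrightarrow> a \<otimes>\<^bsub>G\<^esub> b \<in> W"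
        using \<tau>.openin_mult[OF W(1) xy(1,2) W(2)] by metis
      \<comment> \<open>The sets \<open>nb V1\<close> and \<open>nb V2\<close> control the products;
        their interiors supply the \<open>\<sigma>\<close>-open box.\<close>
      have "intr (nb V1) \<times> intr (nb V2) \<subseteq> ?P"
      proof clarify
        fix u v assume "u \<in> intr (nb V1)" "v \<in> intr (nb V2)"
        then have uv: "u \<in> nb V1" "v \<in> nb V2"
          using intr_subset by blast+
        then have "u \<otimes>\<^bsub>G\<^esub> v \<in> U"
          using nb_mult[OF _ _ V12] W(3) by blast
        then show "(u, v) \<in> topspace (prod_topology \<sigma> \<sigma>) \<and> u \<otimes>\<^bsub>G\<^esub> v \<in> U"
          using uv nb_carrier by (auto simp: top)
      qed
      moreover have "x \<in> intr (nb V1)" "y \<in> intr (nb V2)"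
        using nb_intr V by blast+
      ultimately show "\<exists>A B. openin \<sigma> A \<and> openin \<sigma> B \<and> x \<in> A \<and> y \<in> B \<and> A \<times> B \<subseteq> ?P"
        using open_intr[OF nb_carrier] by meson
    qed
  qed
  have P: "paratopological_group G \<sigma>"
    unfolding paratopological_group_def paratopological_group_axioms_def
    using T.is_group top mult by blast
  have "second_countable \<sigma>"
  proof -
    obtain \<B> where \<B>: "countable \<B>" "\<And>V. V \<in> \<B> \<Longrightarrow> openin \<tau> V"
      "\<And>U x. openin \<tau> U \<Longrightarrow> x \<in> U \<Longrightarrow> \<exists>V\<in>\<B>. x \<in> V \<and> V \<subseteq> U"
      using sc unfolding second_countable_def by metis
    show ?thesis
      unfolding second_countable_def
    \<comment> \<open>A base set inside \<open>V\<close> has its enlargement inside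
      \<open>nb V\<close>, so the \<open>\<sigma>\<close>-interiors of the enlargements of a
      countable \<open>\<tau>\<close>-base form a base.\<close>
    proof (intro exI[of _ "(\<lambda>V. intr (nb V)) ` \<B>"] conjI ballI allI impI)
      show "countable ((\<lambda>V. intr (nb V)) ` \<B>)"
        using \<B>(1) by simp
      show "openin \<sigma> V" if "V \<in> (\<lambda>V. intr (nb V)) ` \<B>" for V
        using that open_intr[OF nb_carrier] by blast
      fix U x assume "openin \<sigma> U \<and> x \<in> U"
      then obtain V where "openin \<tau> V" "x \<in> V" "nb V \<subseteq> U"
        unfolding open_\<sigma> intr_def by blast
      then obtain B where B: "B \<in> \<B>" "x \<in> B" "B \<subseteq> V"
        using \<B>(3) by blast
      then have "x \<in> intr (nb B)" "intr (nb B) \<subseteq> U"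
        using nb_intr[OF \<B>(2)] intr_subset nb_mono[OF B(3)] \<open>nb V \<subseteq> U\<close> by blast+
      then show "\<exists>V\<in>(\<lambda>V. intr (nb V)) ` \<B>. x \<in> V \<and> V \<subseteq> U"
        using B(1) by blast
    qed
  qed
  moreover have "continuous_map T \<sigma> id"
    unfolding continuous_map_def
  proof (intro conjI allI impI)
    show "id \<in> topspace T \<rightarrow> topspace \<sigma>"
      by (simp add: top T.topspace_eq)
    fix U assume U: "openin \<sigma> U"
    have "openin T U"
    proof (subst openin_subopen, intro ballI)
      fix x assume "x \<in> U"
      then obtain V where "openin \<tau> V" "x \<in> V" "nb V \<subseteq> U"
        using U unfolding open_\<sigma> intr_def by blast
      \<comment> \<open>By \<open>near\<close>, the \<open>T\<close>-open set \<open>nb V\<close>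
        contains \<open>x\<close>.\<close>
      then show "\<exists>W. openin T W \<and> x \<in> W \<and> W \<subseteq> U"
        using near[of V] openin_interior_of unfolding nb_def by blast
    qed
    moreover have "{x \<in> topspace T. id x \<in> U} = U"
      using U unfolding open_\<sigma> T.topspace_eq by auto
    ultimately show "openin T {x \<in> topspace T. id x \<in> U}"
      by simp
  qed
  moreover have "continuous_map \<sigma> euclideanreal \<phi>"
    unfolding continuous_map_def
  proof (intro conjI allI impI)
    fix I :: "real set" assume "openin euclideanreal I"
    then have I: "open I" by simp
    show "openin \<sigma> {x \<in> topspace \<sigma>. \<phi> x \<in> I}"
      unfolding open_\<sigma> top
    proof (intro conjI subsetI)
      fix x assume "x \<in> {x \<in> carrier G. \<phi> x \<in> I}"
      then have x: "x \<in> carrier G" "\<phi> x \<in> I" by auto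
      then obtain e where e: "e > 0" "cball (\<phi> x) e \<subseteq> I"
        using I open_contains_cball by blast
      \<comment> \<open>The open ball is pulled back in \<open>\<tau>\<close>, the closed ball in
        \<open>T\<close>. The second preimage is \<open>T\<close>-closed, hence contains the
        \<open>T\<close>-closure of the first and with it \<open>nb ?V\<close>.\<close>
      let ?V = "{y \<in> topspace \<tau>. \<phi> y \<in> ball (\<phi> x) e}"
      let ?C = "{y \<in> topspace T. \<phi> y \<in> cball (\<phi> x) e}"
      have V: "openin \<tau> ?V"
        using \<phi>\<tau> by (rule openin_continuous_map_preimage) simp
      have "closedin T ?C"
        using \<phi>T by (rule closedin_continuous_map_preimage) simp
      moreover have "?V \<subseteq> ?C"
        by (auto simp: T.topspace_eq \<tau>.topspace_eq)
      ultimately have "nb ?V \<subseteq> ?C"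
        using nb_closure closure_of_minimal by blast
      then have "nb ?V \<subseteq> {x \<in> carrier G. \<phi> x \<in> I}"
        using e(2) unfolding T.topspace_eq by blast
      moreover have "x \<in> ?V"
        using x e by (simp add: \<tau>.topspace_eq)
      ultimately show "x \<in> intr {x \<in> carrier G. \<phi> x \<in> I}"
        using V unfolding intr_def by blast
    qed auto
  qed auto
  ultimately show thesis
    using that P by blast
qed

section \<open>The topology that \<open>H\<close> inherits from \<open>K\<close> through
  \<open>G\<close>\<close>

text \<open>
  Openness of \<open>U\<close> asks for an open \<open>V\<close> that is saturated with respect to \<open>\<pi> (ker f)\<close>, which makes
  closure under intersections immediate.
\<close>

lemma correspondence_paratopological_group:
  fixes G :: "('a, 'l) monoid_scheme" and H :: "('b, 'm) monoid_scheme"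
    and K :: "('c, 'n) monoid_scheme"
  assumes G: "group G" and H: "group H" and K: "paratopological_group K S"
    and f: "f \<in> epi G H" and \<pi>: "\<pi> \<in> epi G K"
  obtains \<tau> where "paratopological_group H \<tau>" "second_countable S \<Longrightarrow> second_countable \<tau>"
    "\<And>U. openin \<tau> U \<longleftrightarrow> U \<subseteq> carrier H \<and>
       (\<exists>V. openin S V \<and> (\<forall>x \<in> carrier G. f x \<in> U \<longleftrightarrow> \<pi> x \<in> V))"
proof -
  interpret G: group G by (rule G)
  interpret H: group H by (rule H)
  interpret K: paratopological_group K S by (rule K)
  interpret f: group_hom G H f
    using f by unfold_locales (simp add: epi_def)
  interpret \<pi>: group_hom G K \<pi>
    using \<pi> by unfold_locales (simp add: epi_def)
  have fsurj: "f ` carrier G = carrier H"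
    using f by (simp add: epi_def)
  define lifts where
    "lifts U V \<longleftrightarrow> openin S V \<and> (\<forall>x \<in> carrier G. f x \<in> U \<longleftrightarrow> \<pi> x \<in> V)" for U V
  define \<tau> where "\<tau> = topology (\<lambda>U. U \<subseteq> carrier H \<and> (\<exists>V. lifts U V))"
  \<comment> \<open>The image of \<open>V\<close> under the correspondence from \<open>K\<close> to
    \<open>H\<close> that relates \<open>\<pi> x\<close> to \<open>f x\<close>. Such images of open
    sets will be the basic open sets of \<open>\<tau>\<close>.\<close>
  define F where "F V = f ` {x \<in> carrier G. \<pi> x \<in> V}" for V
  have "istopology (\<lambda>U. U \<subseteq> carrier H \<and> (\<exists>V. lifts U V))"
    unfolding istopology_def
  proof (intro conjI allI impI)
    fix U U' assume "U \<subseteq> carrier H \<and> (\<exists>V. lifts U V)" "U' \<subseteq> carrier H \<and> (\<exists>V. lifts U' V)"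
    then obtain V V' where V: "lifts U V" "lifts U' V'" and sub: "U \<subseteq> carrier H"
      by blast
    then have "lifts (U \<inter> U') (V \<inter> V')"
      by (auto simp: lifts_def)
    then show "\<exists>V. lifts (U \<inter> U') V" by blast
    show "U \<inter> U' \<subseteq> carrier H" using sub by blast
  next
    fix \<K> assume \<K>: "\<forall>U\<in>\<K>. U \<subseteq> carrier H \<and> (\<exists>V. lifts U V)"
    then show "\<Union>\<K> \<subseteq> carrier H" by blast
    obtain v where "\<And>U. U \<in> \<K> \<Longrightarrow> lifts U (v U)"
      using \<K> by metis
    then have "lifts (\<Union>\<K>) (\<Union>U\<in>\<K>. v U)"
      by (auto simp: lifts_def)
    then show "\<exists>V. lifts (\<Union>\<K>) V" by blast
  qed
  then have open_\<tau>: "openin \<tau> U \<longleftrightarrow> U \<subseteq> carrier H \<and> (\<exists>V. lifts U V)" for U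
    by (simp add: \<tau>_def topology_inverse')
  have "lifts (carrier H) (carrier K)"
    using openin_topspace[of S] by (simp add: lifts_def K.topspace_eq)
  then have top: "topspace \<tau> = carrier H"
    by (metis open_\<tau> openin_subset openin_topspace order_refl subset_antisym)
  have open_F: "openin \<tau> (F V)" if V: "openin S V" for V
  proof -
    define N where "N = {n \<in> carrier G. f n = \<one>\<^bsub>H\<^esub>}"
    define V' where "V' = (\<Union>n\<in>N. {k \<in> carrier K. k \<otimes>\<^bsub>K\<^esub> \<pi> n \<in> V})"
    have "openin S {k \<in> carrier K. k \<otimes>\<^bsub>K\<^esub> \<pi> n \<in> V}" if "n \<in> N" for n
      by (rule K.openin_right_translation[OF V]) (use that in \<open>simp add: N_def\<close>)
    then have "openin S V'"
      unfolding V'_def by blast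
    moreover have "f x \<in> F V \<longleftrightarrow> \<pi> x \<in> V'" if x: "x \<in> carrier G" for x
    proof
      assume "f x \<in> F V"
      then obtain g where g: "g \<in> carrier G" "f x = f g" "\<pi> g \<in> V"
        unfolding F_def by blast
      \<comment> \<open>The kernel element that carries \<open>x\<close> to the representative
        \<open>g\<close>.\<close>
      let ?n = "inv\<^bsub>G\<^esub> x \<otimes>\<^bsub>G\<^esub> g"
      have "?n \<in> N"
        using x g by (simp add: N_def)
      moreover have "\<pi> x \<otimes>\<^bsub>K\<^esub> \<pi> ?n = \<pi> g"
        using x g by (simp flip: \<pi>.hom_mult G.m_assoc)
      moreover have "\<pi> x \<in> carrier K"
        using x by simp
      ultimately show "\<pi> x \<in> V'"
        using g(3) unfolding V'_def by (metis (no_types, lifting) UN_iff mem_Collect_eq)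
    next
      assume "\<pi> x \<in> V'"
      then obtain n where n: "n \<in> carrier G" "f n = \<one>\<^bsub>H\<^esub>" "\<pi> x \<otimes>\<^bsub>K\<^esub> \<pi> n \<in> V"
        by (auto simp: N_def V'_def)
      then have "x \<otimes>\<^bsub>G\<^esub> n \<in> carrier G" "\<pi> (x \<otimes>\<^bsub>G\<^esub> n) \<in> V" "f (x \<otimes>\<^bsub>G\<^esub> n) = f x"
        using x by auto
      then show "f x \<in> F V"
        unfolding F_def by (metis (mono_tags, lifting) imageI mem_Collect_eq)
    qed
    ultimately have "lifts (F V) V'"
      by (simp add: lifts_def)
    moreover have "F V \<subseteq> carrier H"
      by (auto simp: F_def)
    ultimately show ?thesis
      unfolding open_\<tau> by (intro conjI exI)
  qed
  have F_mono: "V \<subseteq> W \<Longrightarrow> F V \<subseteq> F W" for V W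
    unfolding F_def by blast
  \<comment> \<open>Surjectivity of \<open>f\<close> lets \<open>U\<close> be recovered from any of
    its lifts, so every \<open>\<tau>\<close>-open set has the form \<open>F V\<close>.\<close>
  have F_lifts: "F V = U" if "lifts U V" "U \<subseteq> carrier H" for U V
  proof -
    have "{x \<in> carrier G. \<pi> x \<in> V} = {x \<in> carrier G. f x \<in> U}"
      using that(1) by (auto simp: lifts_def)
    moreover have "U \<subseteq> f ` carrier G"
      using that(2) fsurj by simp
    ultimately show ?thesis
      unfolding F_def by auto
  qed
  have mult: "continuous_map (prod_topology \<tau> \<tau>) \<tau> (\<lambda>(x, y). x \<otimes>\<^bsub>H\<^esub> y)"
    unfolding continuous_map_def
  proof (intro conjI allI impI)
    show "(\<lambda>(x, y). x \<otimes>\<^bsub>H\<^esub> y) \<in> topspace (prod_topology \<tau> \<tau>) \<rightarrow> topspace \<tau>"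
      by (auto simp: top)
    fix U assume U: "openin \<tau> U"
    then obtain W where W: "lifts U W" by (auto simp: open_\<tau>)
    let ?P = "{p \<in> topspace (prod_topology \<tau> \<tau>). (\<lambda>(x, y). x \<otimes>\<^bsub>H\<^esub> y) p \<in> U}"
    show "openin (prod_topology \<tau> \<tau>) ?P"
      unfolding openin_prod_topology_alt
    proof (intro allI impI)
      fix x y assume "(x, y) \<in> ?P"
      then have xy: "x \<in> carrier H" "y \<in> carrier H" "x \<otimes>\<^bsub>H\<^esub> y \<in> U"
        by (auto simp: top)
      then obtain a b where a: "a \<in> carrier G" "x = f a" and b: "b \<in> carrier G" "y = f b"
        using fsurj by blast
      have "\<pi> (a \<otimes>\<^bsub>G\<^esub> b) \<in> W"
        using W xy(3) a b unfolding lifts_def by (metis G.m_closed f.hom_mult)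
      then have "\<pi> a \<otimes>\<^bsub>K\<^esub> \<pi> b \<in> W"
        using a b by simp
      then obtain V1 V2 where V: "openin S V1" "\<pi> a \<in> V1" "openin S V2" "\<pi> b \<in> V2"
        and V12: "\<And>k l. k \<in> V1 \<Longrightarrow> l \<in> V2 \<Longrightarrow> k \<otimes>\<^bsub>K\<^esub> l \<in> W"
        using K.openin_mult[of W "\<pi> a" "\<pi> b"] W a b unfolding lifts_def by (metis \<pi>.hom_closed)
      \<comment> \<open>Products of representatives fall in \<open>W\<close>, and
        \<open>lifts U W\<close> turns this into membership in \<open>U\<close> whichever
        representatives were chosen.\<close>
      have "F V1 \<times> F V2 \<subseteq> ?P"
      proof clarify
        fix u v assume "u \<in> F V1" "v \<in> F V2"
        then obtain c d where "c \<in> carrier G" "u = f c" "\<pi> c \<in> V1"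
            "d \<in> carrier G" "v = f d" "\<pi> d \<in> V2"
          unfolding F_def by blast
        moreover from this have "\<pi> (c \<otimes>\<^bsub>G\<^esub> d) \<in> W"
          using V12 by simp
        then have "f (c \<otimes>\<^bsub>G\<^esub> d) \<in> U"
          using W calculation unfolding lifts_def by (metis G.m_closed)
        ultimately show "(u, v) \<in> topspace (prod_topology \<tau> \<tau>) \<and> u \<otimes>\<^bsub>H\<^esub> v \<in> U"
          by (simp add: top)
      qed
      moreover have "x \<in> F V1" "y \<in> F V2"
        using a b V unfolding F_def by auto
      ultimately show "\<exists>A B. openin \<tau> A \<and> openin \<tau> B \<and> x \<in> A \<and> y \<in> B \<and> A \<times> B \<subseteq> ?P"
        using open_F V by blast
    qed
  qed
  have P: "paratopological_group H \<tau>"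
    unfolding paratopological_group_def paratopological_group_axioms_def
    using H top mult by blast
  have sc: "second_countable \<tau>" if S: "second_countable S"
  proof -
    obtain \<B> where \<B>: "countable \<B>" "\<And>V. V \<in> \<B> \<Longrightarrow> openin S V"
      "\<And>U x. openin S U \<Longrightarrow> x \<in> U \<Longrightarrow> \<exists>V\<in>\<B>. x \<in> V \<and> V \<subseteq> U"
      using S unfolding second_countable_def by metis
    show ?thesis
      unfolding second_countable_def
    proof (intro exI[of _ "F ` \<B>"] conjI ballI allI impI)
      show "countable (F ` \<B>)"
        using \<B>(1) by simp
      show "openin \<tau> V" if "V \<in> F ` \<B>" for V
        using that \<B>(2) open_F by blast
      fix U x assume "openin \<tau> U \<and> x \<in> U"
      then obtain V where V: "lifts U V" "openin S V" "F V = U" "x \<in> F V"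
        using F_lifts unfolding open_\<tau> lifts_def by blast
      then obtain a where a: "a \<in> carrier G" "x = f a" "\<pi> a \<in> V"
        unfolding F_def by blast
      then obtain B where B: "B \<in> \<B>" "\<pi> a \<in> B" "B \<subseteq> V"
        using \<B>(3) V by blast
      then have "x \<in> F B" "F B \<subseteq> U"
        using a F_mono V unfolding F_def by blast+
      then show "\<exists>V\<in>F ` \<B>. x \<in> V \<and> V \<subseteq> U"
        using B(1) by blast
    qed
  qed
  show thesis
    using that[OF P sc] open_\<tau> unfolding lifts_def by blast
qed

section \<open>Images under d-open maps, and the factorization over \<open>H\<close>\<close>

text \<open>The set \<open>V\<close> in which the image is dense is open in \<open>Y\<close> because
  \<open>f\<close> is onto, and density puts it inside the closure. Only in this form does
  d-openness enter the main argument.\<close>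

lemma d_open_map_subset_interior_closure_of:
  assumes "d_open_map X Y f" "f ` topspace X = topspace Y" "openin X U"
  shows "f ` U \<subseteq> Y interior_of (Y closure_of (f ` U))"
proof -
  obtain V where V: "openin Y V" "f ` U \<subseteq> V" "subtopology Y V closure_of (f ` U) = V"
    using assms unfolding d_open_map_def by auto
  then have "V \<subseteq> Y closure_of (f ` U)"
    using closure_of_subtopology_subset by metis
  then show ?thesis
    using V interior_of_maximal by blast
qed

theorem theorem2p1:
  fixes G :: "('a, 'm) monoid_scheme" and H :: "('b, 'n) monoid_scheme"
    and T\<^sub>G :: "'a topology" and T\<^sub>H :: "'b topology" and f :: "'a \<Rightarrow> 'b"
  assumes "paratopological_group G T\<^sub>G" and "paratopological_group H T\<^sub>H"
    and "f \<in> epi G H" and "continuous_map T\<^sub>G T\<^sub>H f" and "d_open_map T\<^sub>G T\<^sub>H f"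
    and "R_factorizable G T\<^sub>G"
  shows "R_factorizable H T\<^sub>H"
  unfolding R_factorizable_def
proof (intro allI impI)
  interpret G: paratopological_group G T\<^sub>G by fact
  interpret H: paratopological_group H T\<^sub>H by fact
  fix \<phi> :: "'b \<Rightarrow> real" assume \<phi>: "continuous_map T\<^sub>H euclideanreal \<phi>"
  have fsurj: "f ` carrier G = carrier H"
    using assms(3) by (simp add: epi_def)
  have "continuous_map T\<^sub>G euclideanreal (\<phi> \<circ> f)"
    using assms(4) \<phi> by (rule continuous_map_compose)
  then obtain K :: "'a set monoid" and S where K: "paratopological_group K S" "second_countable S"
    and "factors_through G T\<^sub>G (\<phi> \<circ> f) K S"
    using assms(6) unfolding R_factorizable_def by blast
  then obtain \<pi> h where \<pi>: "\<pi> \<in> epi G K" "continuous_map T\<^sub>G S \<pi>"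
    and h: "continuous_map S euclideanreal h"
    and eq: "\<And>x. x \<in> carrier G \<Longrightarrow> \<phi> (f x) = h (\<pi> x)"
    unfolding factors_through_def by auto
  interpret K: paratopological_group K S by (rule K)
  have \<pi>K: "\<pi> x \<in> carrier K" if "x \<in> carrier G" for x
    using \<pi>(1) that by (auto simp: epi_def)
  obtain \<tau> where \<tau>: "paratopological_group H \<tau>" "second_countable \<tau>"
    and open_\<tau>: "\<And>U. openin \<tau> U \<longleftrightarrow> U \<subseteq> carrier H \<and>
       (\<exists>V. openin S V \<and> (\<forall>x \<in> carrier G. f x \<in> U \<longleftrightarrow> \<pi> x \<in> V))"
    using correspondence_paratopological_group[OF G.is_group H.is_group K(1) assms(3) \<pi>(1)] K(2)
    by metis
  interpret \<tau>: paratopological_group H \<tau> by (rule \<tau>)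
  have near: "U \<subseteq> T\<^sub>H interior_of (T\<^sub>H closure_of U)" if U: "openin \<tau> U" for U
  proof -
    obtain V where V: "openin S V" "\<forall>x \<in> carrier G. f x \<in> U \<longleftrightarrow> \<pi> x \<in> V"
      using U open_\<tau> by blast
    \<comment> \<open>The lift \<open>V\<close> makes \<open>U\<close> exactly the image of an open
      subset of \<open>G\<close>, so d-openness of \<open>f\<close> applies to it.\<close>
    let ?O = "{x \<in> topspace T\<^sub>G. \<pi> x \<in> V}"
    have "openin T\<^sub>G ?O"
      using \<pi>(2) V(1) by (rule openin_continuous_map_preimage)
    moreover have "f ` ?O = U"
    proof -
      have "U \<subseteq> f ` carrier G"
        using U open_\<tau> fsurj by blast
      then show ?thesis
        using V(2) unfolding G.topspace_eq by blast
    qed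
    ultimately show ?thesis
      using d_open_map_subset_interior_closure_of[OF assms(5), of ?O] fsurj
      by (simp add: G.topspace_eq H.topspace_eq)
  qed
  have \<phi>\<tau>: "continuous_map \<tau> euclideanreal \<phi>"
    unfolding continuous_map_def
  proof (intro conjI allI impI)
    fix I :: "real set" assume "openin euclideanreal I"
    then have "openin S {k \<in> topspace S. h k \<in> I}"
      by (rule openin_continuous_map_preimage[OF h])
    \<comment> \<open>Since \<phi> after \<open>f\<close> equals \<open>h\<close> after \<pi>, the
      preimages of \<open>I\<close> in \<open>H\<close> and in \<open>K\<close> pull back to the
      same subset of \<open>G\<close>, which is the criterion for
      \<open>\<tau>\<close>-openness.\<close>
    moreover have "\<forall>x \<in> carrier G. f x \<in> {y \<in> topspace \<tau>. \<phi> y \<in> I} \<longleftrightarrow>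
        \<pi> x \<in> {k \<in> topspace S. h k \<in> I}"
      using eq \<pi>K fsurj by (auto simp: \<tau>.topspace_eq K.topspace_eq)
    ultimately show "openin \<tau> {y \<in> topspace \<tau>. \<phi> y \<in> I}"
      unfolding open_\<tau> by (auto simp: \<tau>.topspace_eq)
  qed auto
  obtain \<sigma> where \<sigma>: "paratopological_group H \<sigma>" "second_countable \<sigma>"
    and id: "continuous_map T\<^sub>H \<sigma> id" and \<phi>\<sigma>: "continuous_map \<sigma> euclideanreal \<phi>"
    using coarser_paratopological_group[OF assms(2) \<tau> near \<phi> \<phi>\<tau>] by metis
  have "id \<in> epi H H"
    by (simp add: epi_def hom_def)
  then have "factors_through H T\<^sub>H \<phi> H \<sigma>"
    unfolding factors_through_def using id \<phi>\<sigma> by (metis id_apply)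
  \<comment> \<open>The transfer replaces \<open>H\<close> by a copy whose elements are the fibres
    of the identity, that is singletons, so that the carrier has the required type.\<close>
  with \<sigma> show "\<exists>(K :: 'b set monoid) S.
      paratopological_group K S \<and> second_countable S \<and> factors_through H T\<^sub>H \<phi> K S"
    by (rule factors_through_transfer)
qed

end
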